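(* Let $0<\gamma\le1$, $1<\alpha,\beta\le2$, and $c(x,y,t)\ge0$, $d(x,y,t)\ge0$. Suppose the step sizes satisfy $$0<\frac{\tau^\gamma}{(\Delta x)^\alpha}+\frac{\tau^\gamma}{(\Delta y)^\beta}\le\frac{1-2^{-\gamma}}{\Gamma(2-\gamma)\mathbf C_{\max}},$$ where $$\mathbf C_{\max}=\max_{0\le i\le N_x,\,0\le j\le N_y,\,0\le k\le N_t}\left\{-\frac{\kappa_\alpha(4-2^{3-\alpha})c_{i,j}^k}{\Gamma(4-\alpha)},\,-\frac{\kappa_\beta(4-2^{3-\beta})d_{i,j}^k}{\Gamma(4-\beta)}\right\}.$$ Then the explicit difference scheme (defined in the context) for the two-dimensional time-space Caputo-Riesz fractional diffusion equation ${}_0^C D_t^{\gamma}u=c(x,y,t)\frac{\partial^{\alpha}u}{\partial|x|^{\alpha}}+d(x,y,t)\frac{\partial^{\beta}u}{\partial|y|^{\beta}}+f(x,y,t)$ is stable. That is, if $(u_{i,j}^k)$ and $(\widetilde u_{i,j}^k)$ are two solutions of the scheme with the same $f$ and the same boundary values but possibly different initial values, and $\epsilon_{i,j}^k=\widetilde u_{i,j}^k-u_{i,j}^k$, $\|\mathbf E^k\|_\infty=\max_{0\le i\le N_x,\,0\le j\le N_y}|\epsilon_{i,j}^k|$, then $\|\mathbf E^k\|_\infty\le\|\mathbf E^0\|_\infty$ for all $k=1,\dots,N_t$.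
   Context: Mesh: $x_i=x_L+i\Delta x$ $(0\le i\le N_x)$, $\Delta x=(x_R-x_L)/N_x$; $y_j=y_L+j\Delta y$ $(0\le j\le N_y)$, $\Delta y=(y_R-y_L)/N_y$; $N_x,N_y\ge2$; $t_k=k\tau$ $(0\le k\le N_t)$, $\tau=T/N_t$. Time coefficients: $l_s=(s+1)^{1-\gamma}-s^{1-\gamma}$ for $0<\gamma<1$; for $\gamma=1$, $l_0=1$ and $l_s=0$ for $s\ge1$. Space coefficients: for $\nu\in(1,2]$, $N\ge2$, $1\le i\le N-1$, $0\le m\le N$, put $g_{i,m}^{\nu}=p_{i,m}^{\nu}+q_{i,m}^{\nu}$, where $p_{i,m}^{\nu}=a_{i-1,m}-2a_{i,m}+a_{i+1,m}$ for $m\le i-1$, $p_{i,i}^{\nu}=-2a_{i,i}+a_{i+1,i}$, $p_{i,i+1}^{\nu}=a_{i+1,i+1}$, $p_{i,m}^{\nu}=0$ for $m>i+1$; $q_{i,m}^{\nu}=0$ for $m<i-1$, $q_{i,i-1}^{\nu}=b_{i-1,i-1}$, $q_{i,i}^{\nu}=-2b_{i,i}+b_{i-1,i}$, $q_{i,m}^{\nu}=b_{i-1,m}-2b_{i,m}+b_{i+1,m}$ for $i+1\le m\le N$; $a_{j,0}=(j-1)^{3-\nu}-j^{2-\nu}(j-3+\nu)$ for $j\ge1$, $a_{j,m}=(j-m+1)^{3-\nu}-2(j-m)^{3-\nu}+(j-m-1)^{3-\nu}$ for $1\le m\le j-1$, $a_{j,j}=1$ for $j\ge1$, and $a_{0,0}=0$;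 $b_{j,j}=1$ for $j\le N-1$, $b_{j,m}=(m-j+1)^{3-\nu}-2(m-j)^{3-\nu}+(m-j-1)^{3-\nu}$ for $j+1\le m\le N-1$, $b_{j,N}=(3-\nu-N+j)(N-j)^{2-\nu}+(N-j-1)^{3-\nu}$ for $j\le N-1$, and $b_{N,N}=0$. The coefficients $g_{i,m}^\alpha$ are taken with $\nu=\alpha$, $N=N_x$, and $g_{j,m}^\beta$ with $\nu=\beta$, $N=N_y$. Further, $\kappa_\nu=\frac{1}{2\cos(\nu\pi/2)}<0$, $c_{i,j}^k=c(x_i,y_j,t_k)$, and similarly $d_{i,j}^k,f_{i,j}^k$; $\mu=\Gamma(2-\gamma)\tau^\gamma$, $\sigma'_{i,j,k}=-\frac{\Gamma(2-\gamma)\tau^\gamma\kappa_\alpha c_{i,j}^k}{\Gamma(4-\alpha)(\Delta x)^\alpha}$, $\sigma''_{i,j,k}=-\frac{\Gamma(2-\gamma)\tau^\gamma\kappa_\beta d_{i,j}^k}{\Gamma(4-\beta)(\Delta y)^\beta}$. Explicit scheme: given initial values $u_{i,j}^0$ and prescribed values at boundary nodes ($i\in\{0,N_x\}$ or $j\in\{0,N_y\}$), for $1\le i\le N_x-1$, $1\le j\le N_y-1$, $$u_{i,j}^1=(1+\sigma'_{i,j,0}g_{i,i}^\alpha+\sigma''_{i,j,0}g_{j,j}^\beta)u_{i,j}^0+\sigma'_{i,j,0}\sum_{m=0,m\ne i}^{N_x}g_{i,m}^\alpha u_{m,j}^0+\sigma''_{i,j,0}\sum_{m=0,m\ne j}^{N_y}g_{j,m}^\beta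 u_{i,m}^0+\mu f_{i,j}^0,$$ and for $1\le k\le N_t-1$, $$u_{i,j}^{k+1}=(1-l_1+\sigma'_{i,j,k}g_{i,i}^\alpha+\sigma''_{i,j,k}g_{j,j}^\beta)u_{i,j}^k+\sum_{s=1}^{k-1}(l_s-l_{s+1})u_{i,j}^{k-s}+l_ku_{i,j}^0+\sigma'_{i,j,k}\sum_{m=0,m\ne i}^{N_x}g_{i,m}^\alpha u_{m,j}^k+\sigma''_{i,j,k}\sum_{m=0,m\ne j}^{N_y}g_{j,m}^\beta u_{i,m}^k+\mu f_{i,j}^k.$$ Two solutions with the same boundary values have $\epsilon_{i,j}^k=0$ at all boundary nodes for all $k$. *)

theory Defs
  imports "HOL-Analysis.Analysis"
begin

definition l_coef :: "real \<Rightarrow> nat \<Rightarrow> real" where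
  "l_coef \<gamma> s =
     (if \<gamma> = 1 then (if s = 0 then 1 else 0)
      else real (s + 1) powr (1 - \<gamma>) - real s powr (1 - \<gamma>))"

text \<open>
  The entries \<open>m > j\<close> of \<open>a_coef\<close> and the entries \<open>m < j\<close> or \<open>m > N\<close> of \<open>b_coef\<close> are
  never used below; they are set to zero.
  The only powers with base zero have exponent \<open>3 - \<nu> \<ge> 1\<close> here and \<open>1 - \<gamma> > 0\<close> above,
  so the convention \<open>0 powr r = 0\<close> gives the intended values.
\<close>

definition a_coef :: "real \<Rightarrow> nat \<Rightarrow> nat \<Rightarrow> real" where
  "a_coef \<nu> j m =
     (if m > j then 0
      else if m = j then (if j = 0 then 0 else 1)
      else if m = 0 then
        (real j - 1) powr (3 - \<nu>) - real j powr (2 - \<nu>) * (real j - 3 + \<nu>)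
      else
        (real j - real m + 1) powr (3 - \<nu>) - 2 * (real j - real m) powr (3 - \<nu>)
          + (real j - real m - 1) powr (3 - \<nu>))"

definition b_coef :: "real \<Rightarrow> nat \<Rightarrow> nat \<Rightarrow> nat \<Rightarrow> real" where
  "b_coef \<nu> N j m =
     (if m < j \<or> m > N then 0
      else if m = j then (if j = N then 0 else 1)
      else if m = N then
        (3 - \<nu> - real N + real j) * (real N - real j) powr (2 - \<nu>)
          + (real N - real j - 1) powr (3 - \<nu>)
      else
        (real m - real j + 1) powr (3 - \<nu>) - 2 * (real m - real j) powr (3 - \<nu>)
          + (real m - real j - 1) powr (3 - \<nu>))"

text \<open>The following are used for \<open>1 \<le> i \<le> N - 1\<close> and \<open>m \<le> N\<close> only, so \<open>i - 1\<close> never truncates.\<close>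

definition p_coef :: "real \<Rightarrow> nat \<Rightarrow> nat \<Rightarrow> real" where
  "p_coef \<nu> i m =
     (if m < i then a_coef \<nu> (i - 1) m - 2 * a_coef \<nu> i m + a_coef \<nu> (i + 1) m
      else if m = i then - 2 * a_coef \<nu> i i + a_coef \<nu> (i + 1) i
      else if m = i + 1 then a_coef \<nu> (i + 1) (i + 1)
      else 0)"

definition q_coef :: "real \<Rightarrow> nat \<Rightarrow> nat \<Rightarrow> nat \<Rightarrow> real" where
  "q_coef \<nu> N i m =
     (if m + 1 < i then 0
      else if m + 1 = i then b_coef \<nu> N (i - 1) (i - 1)
      else if m = i then - 2 * b_coef \<nu> N i i + b_coef \<nu> N (i - 1) i
      else b_coef \<nu> N (i - 1) m - 2 * b_coef \<nu> N i m + b_coef \<nu> N (i + 1) m)"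

definition g_coef :: "real \<Rightarrow> nat \<Rightarrow> nat \<Rightarrow> nat \<Rightarrow> real" where
  "g_coef \<nu> N i m = p_coef \<nu> i m + q_coef \<nu> N i m"

definition kappa :: "real \<Rightarrow> real" where
  "kappa \<nu> = 1 / (2 * cos (\<nu> * pi / 2))"

definition mu :: "real \<Rightarrow> real \<Rightarrow> real" where
  "mu \<gamma> \<tau> = Gamma (2 - \<gamma>) * \<tau> powr \<gamma>"

text \<open>
  Common form of \<open>\<sigma>'\<close> (\<open>\<nu> = \<alpha>\<close>, \<open>h = \<Delta>x\<close>, \<open>v\<close> the value of \<open>c\<close>) and
  \<open>\<sigma>''\<close> (\<open>\<nu> = \<beta>\<close>, \<open>h = \<Delta>y\<close>, \<open>v\<close> the value of \<open>d\<close>).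
\<close>

definition sigma :: "real \<Rightarrow> real \<Rightarrow> real \<Rightarrow> real \<Rightarrow> real \<Rightarrow> real" where
  "sigma \<gamma> \<nu> \<tau> h v =
     - (Gamma (2 - \<gamma>) * \<tau> powr \<gamma> * kappa \<nu> * v / (Gamma (4 - \<nu>) * h powr \<nu>))"

definition grid_value ::
  "real \<Rightarrow> real \<Rightarrow> real \<Rightarrow> real \<Rightarrow> real \<Rightarrow> (real \<Rightarrow> real \<Rightarrow> real \<Rightarrow> real)
     \<Rightarrow> nat \<Rightarrow> nat \<Rightarrow> nat \<Rightarrow> real" where
  "grid_value xL yL \<Delta>x \<Delta>y \<tau> w i j k = w (xL + real i * \<Delta>x) (yL + real j * \<Delta>y) (real k * \<tau>)"

text \<open>
  \<open>u\<close> (written \<open>u i j k\<close>, time index last) is a solution of the explicit scheme with grid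
  data \<open>C\<close>, \<open>D\<close>, \<open>F\<close> of the coefficients and the source term, initial values \<open>\<phi>\<close> and
  boundary values \<open>\<psi>\<close>.
\<close>

definition explicit_scheme_solution ::
  "real \<Rightarrow> real \<Rightarrow> real \<Rightarrow> real \<Rightarrow> real \<Rightarrow> real \<Rightarrow> nat \<Rightarrow> nat \<Rightarrow> nat
     \<Rightarrow> (nat \<Rightarrow> nat \<Rightarrow> nat \<Rightarrow> real) \<Rightarrow> (nat \<Rightarrow> nat \<Rightarrow> nat \<Rightarrow> real) \<Rightarrow> (nat \<Rightarrow> nat \<Rightarrow> nat \<Rightarrow> real)
     \<Rightarrow> (nat \<Rightarrow> nat \<Rightarrow> real) \<Rightarrow> (nat \<Rightarrow> nat \<Rightarrow> nat \<Rightarrow> real)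
     \<Rightarrow> (nat \<Rightarrow> nat \<Rightarrow> nat \<Rightarrow> real) \<Rightarrow> bool" where
  "explicit_scheme_solution \<gamma> \<alpha> \<beta> \<tau> \<Delta>x \<Delta>y Nx Ny Nt C D F \<phi> \<psi> u \<longleftrightarrow>
     (\<forall>i\<in>{0..Nx}. \<forall>j\<in>{0..Ny}. u i j 0 = \<phi> i j) \<and>
     (\<forall>k\<in>{0..Nt}. \<forall>i\<in>{0..Nx}. \<forall>j\<in>{0..Ny}.
        i \<in> {0, Nx} \<or> j \<in> {0, Ny} \<longrightarrow> u i j k = \<psi> i j k) \<and>
     (\<forall>i\<in>{1..Nx-1}. \<forall>j\<in>{1..Ny-1}.
        u i j 1 =
          (1 + sigma \<gamma> \<alpha> \<tau> \<Delta>x (C i j 0) * g_coef \<alpha> Nx i i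
             + sigma \<gamma> \<beta> \<tau> \<Delta>y (D i j 0) * g_coef \<beta> Ny j j) * u i j 0
          + sigma \<gamma> \<alpha> \<tau> \<Delta>x (C i j 0) * (\<Sum>m\<in>{0..Nx} - {i}. g_coef \<alpha> Nx i m * u m j 0)
          + sigma \<gamma> \<beta> \<tau> \<Delta>y (D i j 0) * (\<Sum>m\<in>{0..Ny} - {j}. g_coef \<beta> Ny j m * u i m 0)
          + mu \<gamma> \<tau> * F i j 0) \<and>
     (\<forall>k\<in>{1..Nt-1}. \<forall>i\<in>{1..Nx-1}. \<forall>j\<in>{1..Ny-1}.
        u i j (k + 1) =
          (1 - l_coef \<gamma> 1 + sigma \<gamma> \<alpha> \<tau> \<Delta>x (C i j k) * g_coef \<alpha> Nx i i
             + sigma \<gamma> \<beta> \<tau> \<Delta>y (D i j k) * g_coef \<beta> Ny j j) * u i j k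
          + (\<Sum>s=1..k-1. (l_coef \<gamma> s - l_coef \<gamma> (s + 1)) * u i j (k - s))
          + l_coef \<gamma> k * u i j 0
          + sigma \<gamma> \<alpha> \<tau> \<Delta>x (C i j k) * (\<Sum>m\<in>{0..Nx} - {i}. g_coef \<alpha> Nx i m * u m j k)
          + sigma \<gamma> \<beta> \<tau> \<Delta>y (D i j k) * (\<Sum>m\<in>{0..Ny} - {j}. g_coef \<beta> Ny j m * u i m k)
          + mu \<gamma> \<tau> * F i j k)"

definition C_max ::
  "real \<Rightarrow> real \<Rightarrow> nat \<Rightarrow> nat \<Rightarrow> nat
     \<Rightarrow> (nat \<Rightarrow> nat \<Rightarrow> nat \<Rightarrow> real) \<Rightarrow> (nat \<Rightarrow> nat \<Rightarrow> nat \<Rightarrow> real) \<Rightarrow> real" where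
  "C_max \<alpha> \<beta> Nx Ny Nt C D =
     Max (\<Union>(i, j, k) \<in> {0..Nx} \<times> {0..Ny} \<times> {0..Nt}.
            {- (kappa \<alpha> * (4 - 2 powr (3 - \<alpha>)) * C i j k / Gamma (4 - \<alpha>)),
             - (kappa \<beta> * (4 - 2 powr (3 - \<beta>)) * D i j k / Gamma (4 - \<beta>))})"

text \<open>
  For nonnegative coefficients \<open>C_max \<ge> 0\<close>, with value zero
  exactly when the coefficients vanish at all grid points; the upper bound is then infinite.
  The guard \<open>C_max > 0\<close> expresses this, since division by zero yields zero in HOL.
\<close>

definition step_size_condition ::
  "real \<Rightarrow> real \<Rightarrow> real \<Rightarrow> real \<Rightarrow> real \<Rightarrow> real \<Rightarrow> real \<Rightarrow> bool" where
  "step_size_condition \<gamma> \<alpha> \<beta> \<tau> \<Delta>x \<Delta>y M \<longleftrightarrow>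
     0 < \<tau> powr \<gamma> / \<Delta>x powr \<alpha> + \<tau> powr \<gamma> / \<Delta>y powr \<beta> \<and>
     (M > 0 \<longrightarrow>
       \<tau> powr \<gamma> / \<Delta>x powr \<alpha> + \<tau> powr \<gamma> / \<Delta>y powr \<beta>
         \<le> (1 - 2 powr (- \<gamma>)) / (Gamma (2 - \<gamma>) * M))"

definition grid_norm :: "nat \<Rightarrow> nat \<Rightarrow> (nat \<Rightarrow> nat \<Rightarrow> real) \<Rightarrow> real" where
  "grid_norm Nx Ny v = Max ((\<lambda>(i, j). \<bar>v i j\<bar>) ` ({0..Nx} \<times> {0..Ny}))"

end

theory Submission
  imports Defs
begin

text \<open>
  With nonnegative \<open>\<sigma>'\<close>, \<open>\<sigma>''\<close>, every new value of the error is a combination of old ones with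
  nonnegative weights of total at most one, so the maximum norm cannot grow. For this one needs
  that \<open>g\<close> has nonnegative off-diagonal entries and nonpositive row sums, that
  \<open>g i i = - 2 * (4 - 2 powr (3 - \<nu>))\<close>, and that \<open>l\<close> decreases; the step size condition is then
  exactly what makes the weight of \<open>u i j k\<close> nonnegative.
  The entries of \<open>g\<close> away from the boundary columns are fourth central differences of
  \<open>\<bar>x\<bar> powr (3 - \<nu>)\<close>. The row sums of \<open>a\<close> telescope to \<open>(3 - \<nu>) * j powr (2 - \<nu>)\<close>, which is
  concave in \<open>j\<close>.
\<close>

subsection \<open>Differences of powers\<close>

text \<open>The mean value theorem on \<open>[x - 1, x]\<close> and \<open>[x, x + 1]\<close>
  compares two values of \<open>f'\<close>. Differentiability is asked for only beyond
  \<open>a\<close>, since \<open>x - 1\<close> may be \<open>a\<close> itself, where a power can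
  have base zero.\<close>

lemma second_difference_nonneg:
  fixes f f' :: "real \<Rightarrow> real"
  assumes cont: "continuous_on {a..} f"
    and deriv: "\<And>x. x > a \<Longrightarrow> (f has_real_derivative f' x) (at x)"
    and mono: "\<And>x y. a < x \<Longrightarrow> x < y \<Longrightarrow> f' x \<le> f' y"
    and x: "a + 1 \<le> x"
  shows "0 \<le> f (x + 1) - 2 * f x + f (x - 1)"
proof -
  have c: "continuous_on {u..v} f" if "a \<le> u" for u v
    using that by (intro continuous_on_subset[OF cont]) auto
  have d: "f differentiable (at z)" if "a < z" for z
    using deriv[OF that] real_differentiable_def by blast
  obtain l1 z1 where z1: "x - 1 < z1" "z1 < x" "(f has_real_derivative l1) (at z1)"
      "f x - f (x - 1) = (x - (x - 1)) * l1"
    using MVT[of "x - 1" x f] c[of "x - 1" x] d x by auto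
  obtain l2 z2 where z2: "x < z2" "z2 < x + 1" "(f has_real_derivative l2) (at z2)"
      "f (x + 1) - f x = (x + 1 - x) * l2"
    using MVT[of x "x + 1" f] c[of x "x + 1"] d x by auto
  have "l1 = f' z1" "l2 = f' z2"
    using z1 z2 x by (auto intro!: DERIV_unique deriv)
  with mono[of z1 z2] z1 z2 x show ?thesis by simp
qed

lemma powr_second_difference_nonneg:
  fixes p x :: real
  assumes "p \<le> 0" "1 < x"
  shows "0 \<le> (x + 1) powr p - 2 * x powr p + (x - 1) powr p"
proof (rule second_difference_nonneg[where a = "x - 1" and f' = "\<lambda>x. p * x powr (p - 1)"])
  show "continuous_on {x - 1..} (\<lambda>x. x powr p)"
    using assms by (intro continuous_intros) auto
  show "((\<lambda>x. x powr p) has_real_derivative p * y powr (p - 1)) (at y)" if "y > x - 1" for y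
    using that assms by (intro has_real_derivative_powr) auto
  show "p * y powr (p - 1) \<le> p * z powr (p - 1)" if "x - 1 < y" "y < z" for y z
    using that assms by (intro mult_left_mono_neg powr_mono2') auto
qed auto

lemma powr_second_difference_nonpos:
  fixes p x :: real
  assumes "0 \<le> p" "p \<le> 1" "1 \<le> x"
  shows "(x + 1) powr p - 2 * x powr p + (x - 1) powr p \<le> 0"
\<comment> \<open>\<open>0 powr 0 = 0\<close> makes \<open>x powr 0\<close> discontinuous at 0,
  which is reached for \<open>x = 1\<close>; the second difference there is -1.\<close>
proof (cases "p = 0")
  case True
  then show ?thesis using assms by auto
next
  case False
  have "0 \<le> - ((x + 1) powr p) - 2 * - (x powr p) + - ((x - 1) powr p)"
  proof (rule second_difference_nonneg[where a = 0 and f' = "\<lambda>x. - (p * x powr (p - 1))"])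
    show "continuous_on {0..} (\<lambda>x. - (x powr p))"
      using assms False by (intro continuous_intros continuous_on_powr') auto
    show "((\<lambda>x. - (x powr p)) has_real_derivative - (p * y powr (p - 1))) (at y)" if "y > 0" for y
      using that assms by (intro DERIV_minus has_real_derivative_powr) auto
    show "- (p * y powr (p - 1)) \<le> - (p * z powr (p - 1))" if "0 < y" "y < z" for y z
      using that assms by (simp, intro mult_left_mono powr_mono2') auto
  qed (use assms in auto)
  then show ?thesis by simp
qed

text \<open>Convexity again, as a tangent inequality; it gives the sign of the second derivative of
  \<open>edge_powr\<close> below.\<close>

lemma powr_above_tangent:
  fixes p x :: real
  assumes "p \<le> 0" "1 < x"
  shows "0 \<le> (x - 1) powr p - x powr p + p * x powr (p - 1)"
proof -
  have "\<exists>z. x - 1 < z \<and> z < x \<and> x powr p - (x - 1) powr p = (x - (x - 1)) * (p * z powr (p - 1))"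
    using assms by (intro MVT2 has_real_derivative_powr) auto
  then obtain z where z: "x - 1 < z" "z < x" "x powr p - (x - 1) powr p = p * z powr (p - 1)"
    by auto
  have "p * z powr (p - 1) \<le> p * x powr (p - 1)"
    using z assms by (intro mult_left_mono_neg powr_mono2') auto
  with z show ?thesis by simp
qed

section \<open>Convexity of the functions behind the coefficient columns\<close>

lemma mono_of_deriv_nonneg:
  fixes f f' :: "real \<Rightarrow> real"
  assumes "\<And>z. a < z \<Longrightarrow> (f has_real_derivative f' z) (at z)" "\<And>z. a < z \<Longrightarrow> 0 \<le> f' z"
    and "a < x" "x < y"
  shows "f x \<le> f y"
proof (rule DERIV_nonneg_imp_nondecreasing[of x y f])
  show "\<exists>y. (f has_real_derivative y) (at z) \<and> 0 \<le> y" if "x \<le> z" for z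
    using assms that by (intro exI[of _ "f' z"]) auto
qed (use assms in auto)

lemma has_real_derivative_powr_shift:
  fixes x :: real
  shows "0 < x + c \<Longrightarrow> ((\<lambda>x. (x + c) powr p) has_real_derivative p * (x + c) powr (p - 1)) (at x)"
    and "c < x \<Longrightarrow> ((\<lambda>x. (x - c) powr p) has_real_derivative p * (x - c) powr (p - 1)) (at x)"
  by (auto intro!: derivative_eq_intros simp: powr_diff)

lemmas powr_combination_deriv =
  DERIV_add DERIV_diff DERIV_cmult has_real_derivative_powr_shift has_real_derivative_powr

text \<open>The inner entries of \<open>a_coef\<close>, with \<open>r = 3 - \<nu>\<close> and
  \<open>x = j - m\<close>.\<close>

definition second_diff_powr :: "real \<Rightarrow> real \<Rightarrow> real" where
  "second_diff_powr r x = (x + 1) powr r - 2 * x powr r + (x - 1) powr r"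

text \<open>Column \<open>m = 0\<close> of \<open>a_coef\<close>, with \<open>r = 3 - \<nu>\<close>
  and \<open>x = j\<close>; it is the gap at \<open>x - 1\<close> between the power and its tangent
  at \<open>x\<close>.\<close>

definition edge_powr :: "real \<Rightarrow> real \<Rightarrow> real" where
  "edge_powr r x = (x - 1) powr r - x powr r + r * x powr (r - 1)"

text \<open>The second derivative is \<open>r * (r - 1)\<close> times the second difference of
  \<open>x powr (r - 2)\<close>, a convex function as \<open>r \<le> 2\<close>. The start
  \<open>a = 1\<close> admits \<open>x = 2\<close>, where base 0 occurs.\<close>

lemma second_diff_powr_convex:
  assumes r: "1 \<le> r" "r \<le> 2" and "2 \<le> x"
  shows "0 \<le> second_diff_powr r (x + 1) - 2 * second_diff_powr r x + second_diff_powr r (x - 1)"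
proof (rule second_difference_nonneg[where a = 1 and f = "second_diff_powr r"
      and f' = "\<lambda>x. r * ((x + 1) powr (r - 1) - 2 * x powr (r - 1) + (x - 1) powr (r - 1))"])
  show "continuous_on {1..} (second_diff_powr r)"
    unfolding second_diff_powr_def using r by (intro continuous_intros continuous_on_powr') auto
  show "(second_diff_powr r has_real_derivative
      r * ((x + 1) powr (r - 1) - 2 * x powr (r - 1) + (x - 1) powr (r - 1))) (at x)"
    if "x > 1" for x
    unfolding second_diff_powr_def
    by (rule DERIV_cong, (rule powr_combination_deriv | use that in linarith)+)
      (simp add: algebra_simps)
  show "r * ((x + 1) powr (r - 1) - 2 * x powr (r - 1) + (x - 1) powr (r - 1))
      \<le> r * ((y + 1) powr (r - 1) - 2 * y powr (r - 1) + (y - 1) powr (r - 1))"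
    if "1 < x" "x < y" for x y
  proof (rule mono_of_deriv_nonneg[where a = 1 and
      f = "\<lambda>x. r * ((x + 1) powr (r - 1) - 2 * x powr (r - 1) + (x - 1) powr (r - 1))" and
      f' = "\<lambda>x. r * (r - 1) *
      ((x + 1) powr (r - 2) - 2 * x powr (r - 2) + (x - 1) powr (r - 2))"])
    show "((\<lambda>x. r * ((x + 1) powr (r - 1) - 2 * x powr (r - 1) + (x - 1) powr (r - 1)))
        has_real_derivative r * (r - 1) *
          ((z + 1) powr (r - 2) - 2 * z powr (r - 2) + (z - 1) powr (r - 2))) (at z)"
      if "1 < z" for z
      by (rule DERIV_cong, (rule powr_combination_deriv | use that in linarith)+)
      (simp add: algebra_simps)
    show "0 \<le> r * (r - 1) * ((z + 1) powr (r - 2) - 2 * z powr (r - 2) + (z - 1) powr (r - 2))"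
      if "1 < z" for z
      using that r by (intro mult_nonneg_nonneg powr_second_difference_nonneg) auto
  qed (use that in auto)
qed (use assms in auto)

text \<open>Here the second derivative is \<open>r * (r - 1)\<close> times the tangent gap of
  \<open>x powr (r - 2)\<close>.\<close>

lemma edge_powr_convex:
  assumes r: "1 \<le> r" "r \<le> 2" and "2 \<le> x"
  shows "0 \<le> edge_powr r (x + 1) - 2 * edge_powr r x + edge_powr r (x - 1)"
proof (rule second_difference_nonneg[where a = 1 and f = "edge_powr r"
      and f' = "\<lambda>x. r * ((x - 1) powr (r - 1) - x powr (r - 1) + (r - 1) * x powr (r - 2))"])
  show "continuous_on {1..} (edge_powr r)"
    unfolding edge_powr_def using r by (intro continuous_intros continuous_on_powr') auto
  show "(edge_powr r has_real_derivative
      r * ((x - 1) powr (r - 1) - x powr (r - 1) + (r - 1) * x powr (r - 2))) (at x)"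
    if "x > 1" for x
    unfolding edge_powr_def
    by (rule DERIV_cong, (rule powr_combination_deriv | use that in linarith)+)
      (simp add: algebra_simps)
  show "r * ((x - 1) powr (r - 1) - x powr (r - 1) + (r - 1) * x powr (r - 2))
      \<le> r * ((y - 1) powr (r - 1) - y powr (r - 1) + (r - 1) * y powr (r - 2))"
    if "1 < x" "x < y" for x y
  proof (rule mono_of_deriv_nonneg[where a = 1 and
      f = "\<lambda>x. r * ((x - 1) powr (r - 1) - x powr (r - 1) + (r - 1) * x powr (r - 2))" and
      f' = "\<lambda>x. r * (r - 1) *
      ((x - 1) powr (r - 2) - x powr (r - 2) + (r - 2) * x powr (r - 2 - 1))"])
    show "((\<lambda>x. r * ((x - 1) powr (r - 1) - x powr (r - 1) + (r - 1) * x powr (r - 2)))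
        has_real_derivative r * (r - 1) *
          ((z - 1) powr (r - 2) - z powr (r - 2) + (r - 2) * z powr (r - 2 - 1))) (at z)"
      if "1 < z" for z
      by (rule DERIV_cong, (rule powr_combination_deriv | use that in linarith)+)
      (simp add: algebra_simps)
    show "0 \<le> r * (r - 1) * ((z - 1) powr (r - 2) - z powr (r - 2) + (r - 2) * z powr (r - 2 - 1))"
      if "1 < z" for z
      using that r by (intro mult_nonneg_nonneg powr_above_tangent) auto
  qed (use that in auto)
qed (use assms in auto)

lemma fourth_difference_at_one_nonneg:
  fixes r :: real
  assumes "r \<le> 2"
  shows "0 \<le> 3 powr r - 4 * 2 powr r + 7"
proof -
  \<comment> \<open>Equality holds at \<open>r = 2\<close>, where the terms are \<open>9\<close>, \<open>16\<close>, \<open>7\<close>; these give the weights for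
    convexity of \<open>exp\<close>, and \<open>3 ^ 9 \<le> 2 ^ 16\<close> leaves room.\<close>
  define u where "u = 2 - r"
  have u: "0 \<le> u" using assms by (simp add: u_def)
  \<comment> \<open>\<open>243 = 3 ^ 5\<close> and \<open>256 = 2 ^ 8\<close> give
    \<open>9 * ln 3 \<le> 14.4 * ln 2\<close>, within the \<open>16 * ln 2\<close> wanted.\<close>
  have "ln (243::real) \<le> ln 256" by (subst ln_le_cancel_iff) auto
  moreover have "ln (243::real) = 5 * ln 3" "ln (256::real) = 8 * ln 2"
    using ln_realpow[of "3::real" 5] ln_realpow[of "2::real" 8] by simp_all
  ultimately have l: "5 * ln 3 \<le> 8 * ln (2::real)" by linarith
  have "9 * ln (3::real) \<le> 16 * ln 2"
    using l ln_ge_zero[of "2::real"] by linarith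
  then have "u * (9 * ln 3) \<le> u * (16 * ln (2::real))" using u by (rule mult_left_mono)
  then have "exp (- u * ln 2) \<le> exp ((1 - 9/16) *\<^sub>R 0 + (9/16) *\<^sub>R (- u * ln (3::real)))"
    by (simp add: algebra_simps)
  also have "\<dots> \<le> (1 - 9/16) * exp 0 + 9/16 * exp (- u * ln 3)"
    by (rule convex_onD[OF exp_convex]) auto
  finally have "16 * 2 powr (- u) \<le> 7 + 9 * 3 powr (- u)"
    by (simp add: powr_def)
  moreover have "4 * 2 powr r = 16 * 2 powr (- u)" "3 powr r = 9 * 3 powr (- u)"
    by (simp_all add: u_def powr_diff)
  ultimately show ?thesis by simp
qed

subsection \<open>The space coefficients\<close>

lemma a_coef_inner: "1 \<le> m \<Longrightarrow> m < j \<Longrightarrow> a_coef \<nu> j m = second_diff_powr (3 - \<nu>) (real j - real m)"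
  by (simp add: a_coef_def second_diff_powr_def)

lemma a_coef_edge: "1 \<le> j \<Longrightarrow> a_coef \<nu> j 0 = edge_powr (3 - \<nu>) (real j)"
  using powr_mult_base[of "real j" "2 - \<nu>"]
  by (simp add: a_coef_def edge_powr_def algebra_simps)

text \<open>The zeros of \<open>a_coef\<close> above the diagonal turn all four cases into one
  second difference in the row index.\<close>

lemma p_coef_eq:
  "1 \<le> i \<Longrightarrow> p_coef \<nu> i m = a_coef \<nu> (i - 1) m - 2 * a_coef \<nu> i m + a_coef \<nu> (i + 1) m"
  by (auto simp: p_coef_def a_coef_def)

text \<open>Reflecting the grid exchanges the right-sided and the left-sided coefficients;
  \<open>b_coef \<nu> N N N = 0\<close> matches \<open>a_coef \<nu> 0 0 = 0\<close>.\<close>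

lemma b_coef_eq_a_coef:
  "j \<le> N \<Longrightarrow> m \<le> N \<Longrightarrow> b_coef \<nu> N j m = a_coef \<nu> (N - j) (N - m)"
  by (auto simp: b_coef_def a_coef_def algebra_simps of_nat_diff)

text \<open>The reflection swaps rows \<open>i - 1\<close> and \<open>i + 1\<close>, which leaves a
  second difference unchanged; facts about \<open>q_coef\<close> thus reduce to facts about
  \<open>p_coef\<close>.\<close>

lemma q_coef_eq_p_coef:
  assumes "1 \<le> i" "i < N" "m \<le> N"
  shows "q_coef \<nu> N i m = p_coef \<nu> (N - i) (N - m)"
proof -
  have "N - (i - 1) = N - i + 1" "N - (i + 1) = N - i - 1" using assms by auto
  then have "q_coef \<nu> N i m = a_coef \<nu> (N - i - 1) (N - m) - 2 * a_coef \<nu> (N - i) (N - m)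
      + a_coef \<nu> (N - i + 1) (N - m)"
    using assms by (auto simp: q_coef_def b_coef_eq_a_coef) (auto simp: a_coef_def)
  then show ?thesis using assms by (simp add: p_coef_eq)
qed

lemma g_coef_eq:
  "1 \<le> i \<Longrightarrow> i < N \<Longrightarrow> m \<le> N \<Longrightarrow> g_coef \<nu> N i m = p_coef \<nu> i m + p_coef \<nu> (N - i) (N - m)"
  by (simp add: g_coef_def q_coef_eq_p_coef)

lemma g_coef_diag:
  assumes "1 \<le> i" "i < N"
  shows "g_coef \<nu> N i i = - 2 * (4 - 2 powr (3 - \<nu>))"
proof -
  have "p_coef \<nu> i i = 2 powr (3 - \<nu>) - 4" if "1 \<le> i" for i
    using that by (simp add: p_coef_def a_coef_def)
  from this[of i] this[of "N - i"] show ?thesis using assms by (simp add: g_coef_eq)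
qed

text \<open>Two or more places below the diagonal the reflected term is zero and
  \<open>p_coef\<close> is a second difference of \<open>edge_powr\<close> (column 0) or
  \<open>second_diff_powr\<close>. Next to the diagonal \<open>p_coef\<close> alone can be negative;
  the 1 from the reflected term makes up for it.\<close>

lemma g_coef_lower_nonneg:
  assumes \<nu>: "1 < \<nu>" "\<nu> \<le> 2" and i: "1 \<le> i" "i < N" and m: "m < i"
  shows "0 \<le> p_coef \<nu> i m + p_coef \<nu> (N - i) (N - m)"
proof -
  let ?r = "3 - \<nu>"
  have r: "1 \<le> ?r" "?r \<le> 2" using \<nu> by auto
  consider "m + 1 < i" "m = 0" | "m + 1 < i" "1 \<le> m" | "m + 1 = i" "m = 0" | "m + 1 = i" "1 \<le> m"
    using m by linarith
  then show ?thesis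
  proof cases
    case 1
    then have "p_coef \<nu> (N - i) (N - m) = 0" using i by (auto simp: p_coef_def)
    moreover have "p_coef \<nu> i m
        = edge_powr ?r (real i + 1) - 2 * edge_powr ?r (real i) + edge_powr ?r (real i - 1)"
      using 1 by (simp add: p_coef_eq a_coef_edge of_nat_diff add.commute)
    ultimately show ?thesis using edge_powr_convex[OF r, of "real i"] 1 by simp
  next
    case 2
    then have "p_coef \<nu> (N - i) (N - m) = 0" using i by (auto simp: p_coef_def)
    moreover have "p_coef \<nu> i m = second_diff_powr ?r (real i - real m + 1)
        - 2 * second_diff_powr ?r (real i - real m) + second_diff_powr ?r (real i - real m - 1)"
      using 2 by (simp add: p_coef_eq a_coef_inner of_nat_diff algebra_simps)
    ultimately show ?thesis
      using second_diff_powr_convex[OF r, of "real i - real m"] 2 by simp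
  next
    case 3
    have [simp]: "i = 1" using 3 by simp
    have "p_coef \<nu> (N - i) (N - m) = 1" using i 3 by (auto simp: p_coef_def a_coef_def)
    moreover have "p_coef \<nu> i m = edge_powr ?r 2 - 2 * edge_powr ?r 1"
      using 3 by (simp add: p_coef_eq a_coef_edge) (simp add: a_coef_def)
    \<comment> \<open>Row 0 enters as \<open>a_coef \<nu> 0 0 = 0\<close>, outside the range of
      \<open>edge_powr_convex\<close>, so the entry is expanded; both factors are nonnegative for
      \<open>1 \<le> ?r \<le> 2\<close>.\<close>
    moreover have "1 + edge_powr ?r 2 - 2 * edge_powr ?r 1 = (2 - ?r) * (2 - 2 powr (?r - 1))"
      using powr_mult_base[of 2 "?r - 1"] by (simp add: edge_powr_def algebra_simps)
    moreover have "2 powr (?r - 1) \<le> (2::real)"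
      using powr_mono[of "?r - 1" 1 2] \<nu> by simp
    ultimately show ?thesis
      using mult_nonneg_nonneg[of "2 - ?r" "2 - 2 powr (?r - 1)"] r by linarith
  next
    case 4
    have "p_coef \<nu> (N - i) (N - m) = 1" using i 4 by (auto simp: p_coef_def a_coef_def)
    moreover have "p_coef \<nu> i m = 3 powr ?r - 4 * 2 powr ?r + 6"
      using 4 by (auto simp: p_coef_eq a_coef_inner second_diff_powr_def) (auto simp: a_coef_def)
    ultimately show ?thesis using fourth_difference_at_one_nonneg[OF r(2)] by simp
  qed
qed

lemma g_coef_off_diag_nonneg:
  assumes \<nu>: "1 < \<nu>" "\<nu> \<le> 2" and i: "1 \<le> i" "i < N" and m: "m \<le> N" "m \<noteq> i"
  shows "0 \<le> g_coef \<nu> N i m"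
proof (cases "m < i")
  case True
  then show ?thesis using g_coef_lower_nonneg[OF \<nu> i] i m by (simp add: g_coef_eq)
next
  case False
  \<comment> \<open>Above the diagonal, reflection leads back to the lower part and swaps the two
    summands.\<close>
  then show ?thesis
    using g_coef_lower_nonneg[OF \<nu>, of "N - i" N "N - m"] i m
    by (simp add: g_coef_eq add.commute diff_less_mono2)
qed

section \<open>Row sums and diagonal dominance\<close>

lemma sum_second_diff_powr:
  assumes "0 < r"
  shows "(\<Sum>s=1..n. second_diff_powr r (real s)) = (real n + 1) powr r - real n powr r - 1"
  by (induction n) (use assms in \<open>auto simp: second_diff_powr_def algebra_simps\<close>)

text \<open>The inner sum cancels the diagonal 1 and the two pure powers of the edge entry. The
  remaining tangent term is \<open>Gamma (4 - \<nu>)\<close> times the fractional integral of order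
  \<open>2 - \<nu>\<close> of the constant 1.\<close>

lemma a_coef_row_sum:
  assumes "\<nu> \<le> 2" "j \<le> n"
  shows "(\<Sum>m\<le>n. a_coef \<nu> j m) = (3 - \<nu>) * real j powr (2 - \<nu>)"
proof (cases "j = 0")
  \<comment> \<open>Both sides vanish, also for \<open>\<nu> = 2\<close>, by
    \<open>0 powr 0 = 0\<close>.\<close>
  case True
  then show ?thesis by (simp add: a_coef_def sum.neutral)
next
  case False
  have "(\<Sum>m\<le>n. a_coef \<nu> j m) = (\<Sum>m\<in>{0} \<union> {j} \<union> {1..<j}. a_coef \<nu> j m)"
    using assms by (intro sum.mono_neutral_right) (auto simp: a_coef_def)
  also have "\<dots> = a_coef \<nu> j 0 + a_coef \<nu> j j + (\<Sum>m\<in>{1..<j}. a_coef \<nu> j m)"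
    using False by (subst sum.union_disjoint) auto
  also have "(\<Sum>m\<in>{1..<j}. a_coef \<nu> j m) = (\<Sum>s=1..j-1. second_diff_powr (3 - \<nu>) (real s))"
    by (rule sum.reindex_bij_witness[of _ "\<lambda>s. j - s" "\<lambda>m. j - m"])
       (auto simp: a_coef_inner of_nat_diff)
  also have "\<dots> = real j powr (3 - \<nu>) - (real j - 1) powr (3 - \<nu>) - 1"
    using assms False by (subst sum_second_diff_powr) (auto simp: of_nat_diff)
  finally show ?thesis using False by (simp add: a_coef_edge edge_powr_def) (simp add: a_coef_def)
qed

lemma p_coef_row_sum_nonpos:
  assumes "1 < \<nu>" "\<nu> \<le> 2" "1 \<le> i" "i < n"
  shows "(\<Sum>m\<le>n. p_coef \<nu> i m) \<le> 0"
proof -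
  have "(\<Sum>m\<le>n. p_coef \<nu> i m) = (\<Sum>m\<le>n. a_coef \<nu> (i - 1) m) - 2 * (\<Sum>m\<le>n. a_coef \<nu> i m)
      + (\<Sum>m\<le>n. a_coef \<nu> (i + 1) m)"
    using assms by (simp add: p_coef_eq sum.distrib sum_subtractf sum_distrib_left)
  also have "\<dots> = (3 - \<nu>) * ((real i + 1) powr (2 - \<nu>) - 2 * real i powr (2 - \<nu>)
      + (real i - 1) powr (2 - \<nu>))"
    using assms by (simp add: a_coef_row_sum of_nat_diff algebra_simps)
  also have "\<dots> \<le> 0"
    using assms by (intro mult_nonneg_nonpos powr_second_difference_nonpos) auto
  finally show ?thesis .
qed

lemma g_coef_row_sum_nonpos:
  assumes "1 < \<nu>" "\<nu> \<le> 2" "1 \<le> i" "i < N"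
  shows "(\<Sum>m\<in>{0..N}. g_coef \<nu> N i m) \<le> 0"
proof -
  have "(\<Sum>m\<in>{0..N}. g_coef \<nu> N i m) = (\<Sum>m\<le>N. p_coef \<nu> i m) + (\<Sum>m\<le>N. p_coef \<nu> (N - i) (N - m))"
    using assms by (simp add: g_coef_eq sum.distrib atLeast0AtMost)
  also have "(\<Sum>m\<le>N. p_coef \<nu> (N - i) (N - m)) = (\<Sum>m\<le>N. p_coef \<nu> (N - i) m)"
    by (rule sum.reindex_bij_witness[of _ "\<lambda>m. N - m" "\<lambda>m. N - m"]) auto
  finally show ?thesis
    using p_coef_row_sum_nonpos[of \<nu> i N] p_coef_row_sum_nonpos[of \<nu> "N - i" N] assms by fastforce
qed

text \<open>Diagonal dominance: with a nonpositive row sum, the off-diagonal weights add up to at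
  most \<open>- g i\<close>.\<close>

lemma off_diag_sum_bound:
  fixes g v :: "'a \<Rightarrow> real"
  assumes "finite S" "i \<in> S"
    and g: "\<And>m. m \<in> S \<Longrightarrow> m \<noteq> i \<Longrightarrow> 0 \<le> g m" and v: "\<And>m. m \<in> S \<Longrightarrow> \<bar>v m\<bar> \<le> E"
    and row: "sum g S \<le> 0"
  shows "\<bar>\<Sum>m\<in>S - {i}. g m * v m\<bar> \<le> - g i * E"
proof -
  have E: "0 \<le> E" using v[OF \<open>i \<in> S\<close>] by simp
  have "\<bar>\<Sum>m\<in>S - {i}. g m * v m\<bar> \<le> (\<Sum>m\<in>S - {i}. g m * E)"
    using g v by (intro order_trans[OF sum_abs] sum_mono) (auto simp: abs_mult intro: mult_left_mono)
  also have "\<dots> = (sum g S - g i) * E"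
    using assms(1,2) by (simp add: sum_diff1 flip: sum_distrib_right)
  also have "\<dots> \<le> - g i * E"
    using row E by (intro mult_right_mono) auto
  finally show ?thesis .
qed

lemma g_coef_off_diag_sum_bound:
  assumes "1 < \<nu>" "\<nu> \<le> 2" "1 \<le> i" "i < N" "\<And>m. m \<le> N \<Longrightarrow> \<bar>v m\<bar> \<le> E"
  shows "\<bar>\<Sum>m\<in>{0..N} - {i}. g_coef \<nu> N i m * v m\<bar> \<le> - g_coef \<nu> N i i * E"
  using assms by (intro off_diag_sum_bound g_coef_row_sum_nonpos g_coef_off_diag_nonneg) auto

subsection \<open>The time coefficients\<close>

lemma l_coef_one: "l_coef \<gamma> 1 = 2 powr (1 - \<gamma>) - 1"
  by (simp add: l_coef_def)

lemma l_coef_nonneg: "\<gamma> \<le> 1 \<Longrightarrow> 0 \<le> l_coef \<gamma> s"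
  by (auto simp: l_coef_def intro: powr_mono2)

text \<open>Concavity of \<open>x powr (1 - \<gamma>)\<close> at the middle point
  \<open>s + 1\<close>.\<close>

lemma l_coef_decreasing:
  assumes "0 < \<gamma>" "\<gamma> \<le> 1"
  shows "l_coef \<gamma> (s + 1) \<le> l_coef \<gamma> s"
  using powr_second_difference_nonpos[of "1 - \<gamma>" "real (s + 1)"] assms
  by (auto simp: l_coef_def algebra_simps)

subsection \<open>The step size condition\<close>

lemma kappa_neg:
  assumes "1 < \<nu>" "\<nu> \<le> 2"
  shows "kappa \<nu> < 0"
proof -
  have "pi / 2 < \<nu> * pi / 2" "\<nu> * pi / 2 \<le> pi" using assms by auto
  then have "cos (\<nu> * pi / 2) < cos (pi / 2)"
    by (intro cos_monotone_0_pi) auto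
  then show ?thesis by (simp add: kappa_def divide_neg_pos divide_pos_neg)
qed

lemma sigma_nonneg:
  assumes "\<gamma> \<le> 1" "1 < \<nu>" "\<nu> \<le> 2" "0 \<le> v"
  shows "0 \<le> sigma \<gamma> \<nu> \<tau> h v"
proof -
  have "0 < Gamma (2 - \<gamma>)" "0 < Gamma (4 - \<nu>)" using assms by (auto intro!: Gamma_real_pos)
  then show ?thesis unfolding sigma_def using kappa_neg[of \<nu>] assms
    by (simp add: divide_nonpos_nonneg mult_nonneg_nonpos mult_nonpos_nonneg)
qed

text \<open>Rearranged so that the last factor belongs to the set maximised in
  \<open>C_max\<close>.\<close>

lemma sigma_g_coef_diag:
  assumes "1 \<le> i" "i < N"
  shows "sigma \<gamma> \<nu> \<tau> h v * g_coef \<nu> N i i = - 2 * Gamma (2 - \<gamma>) * (\<tau> powr \<gamma> / h powr \<nu>)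
    * - (kappa \<nu> * (4 - 2 powr (3 - \<nu>)) * v / Gamma (4 - \<nu>))"
  by (simp add: g_coef_diag[OF assms] sigma_def algebra_simps add_divide_distrib diff_divide_distrib)

lemma C_max_ge:
  assumes "i \<le> Nx" "j \<le> Ny" "k \<le> Nt"
  shows "- (kappa \<alpha> * (4 - 2 powr (3 - \<alpha>)) * C i j k / Gamma (4 - \<alpha>)) \<le> C_max \<alpha> \<beta> Nx Ny Nt C D"
    and "- (kappa \<beta> * (4 - 2 powr (3 - \<beta>)) * D i j k / Gamma (4 - \<beta>)) \<le> C_max \<alpha> \<beta> Nx Ny Nt C D"
  unfolding C_max_def using assms by (intro Max_ge; force)+

text \<open>Both the diagonal terms and \<open>1 - l_coef \<gamma> 1\<close> carry a factor 2. Once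
  it is divided out and the coefficients are bounded by \<open>C_max\<close>, the step size
  condition remains.\<close>

lemma diag_weight_nonneg:
  assumes \<gamma>: "\<gamma> \<le> 1" and step: "step_size_condition \<gamma> \<alpha> \<beta> \<tau> \<Delta>x \<Delta>y (C_max \<alpha> \<beta> Nx Ny Nt C D)"
    and i: "1 \<le> i" "i < Nx" and j: "1 \<le> j" "j < Ny" and k: "k \<le> Nt"
    and "\<gamma> > 0"
  shows "0 \<le> 1 - l_coef \<gamma> 1 + sigma \<gamma> \<alpha> \<tau> \<Delta>x (C i j k) * g_coef \<alpha> Nx i i
             + sigma \<gamma> \<beta> \<tau> \<Delta>y (D i j k) * g_coef \<beta> Ny j j"
proof -
  let ?G = "Gamma (2 - \<gamma>)" and ?M = "C_max \<alpha> \<beta> Nx Ny Nt C D"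
  let ?X = "\<tau> powr \<gamma> / \<Delta>x powr \<alpha>" and ?Y = "\<tau> powr \<gamma> / \<Delta>y powr \<beta>"
  have G: "0 < ?G" using \<gamma> by (intro Gamma_real_pos) auto
  have "- 2 * ?G * ?X * ?M \<le> sigma \<gamma> \<alpha> \<tau> \<Delta>x (C i j k) * g_coef \<alpha> Nx i i"
    unfolding sigma_g_coef_diag[OF i] using G i j k
    by (intro mult_left_mono_neg C_max_ge) auto
  moreover have "- 2 * ?G * ?Y * ?M \<le> sigma \<gamma> \<beta> \<tau> \<Delta>y (D i j k) * g_coef \<beta> Ny j j"
    unfolding sigma_g_coef_diag[OF j] using G i j k
    by (intro mult_left_mono_neg C_max_ge) auto
  moreover have "?G * ((?X + ?Y) * ?M) \<le> 1 - 2 powr (- \<gamma>)"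
  proof (cases "?M > 0")
    case True
    then have "?X + ?Y \<le> (1 - 2 powr (- \<gamma>)) / (?G * ?M)"
      using step by (simp add: step_size_condition_def)
    then show ?thesis using True G by (simp add: pos_le_divide_eq mult_ac)
  next
    \<comment> \<open>The step size condition gives no upper bound here, but
      \<open>?M \<le> 0\<close> makes the product nonpositive.\<close>
    case False
    then have "?G * ((?X + ?Y) * ?M) \<le> 0"
      using G by (intro mult_nonneg_nonpos) auto
    also have "0 \<le> 1 - 2 powr (- \<gamma>)"
      using \<open>\<gamma> > 0\<close> powr_mono[of "- \<gamma>" 0 2] by simp
    finally show ?thesis .
  qed
  moreover have "1 - l_coef \<gamma> 1 = 2 * (1 - 2 powr (- \<gamma>))"
    unfolding l_coef_one by (simp add: powr_diff powr_minus divide_inverse)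
  ultimately show ?thesis by (simp add: algebra_simps)
qed

subsection \<open>Propagation of the error\<close>

lemmas explicit_scheme_boundary =
  explicit_scheme_solution_def[THEN iffD1, THEN conjunct2, THEN conjunct1, rule_format]
lemmas explicit_scheme_first_step =
  explicit_scheme_solution_def[THEN iffD1, THEN conjunct2, THEN conjunct2, THEN conjunct1,
    rule_format]
lemmas explicit_scheme_step =
  explicit_scheme_solution_def[THEN iffD1, THEN conjunct2, THEN conjunct2, THEN conjunct2,
    rule_format]

lemma grid_norm_ge: "i \<le> Nx \<Longrightarrow> j \<le> Ny \<Longrightarrow> \<bar>v i j\<bar> \<le> grid_norm Nx Ny v"
  unfolding grid_norm_def by (intro Max_ge) (auto intro!: image_eqI[of _ _ "(i, j)"])

lemma grid_norm_le: "(\<And>i j. i \<le> Nx \<Longrightarrow> j \<le> Ny \<Longrightarrow> \<bar>v i j\<bar> \<le> E) \<Longrightarrow> grid_norm Nx Ny v \<le> E"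
  unfolding grid_norm_def by (intro Max.boundedI) auto

lemma abs_five_term_bound:
  fixes w :: real
  assumes "0 \<le> w" "\<bar>e\<bar> \<le> E" "\<bar>h\<bar> \<le> H" "0 \<le> s" "\<bar>S\<bar> \<le> P" "0 \<le> s'" "\<bar>S'\<bar> \<le> P'"
  shows "\<bar>w * e + h + s * S + s' * S'\<bar> \<le> w * E + H + s * P + s' * P'"
proof -
  have "\<bar>w * e\<bar> \<le> w * E" "\<bar>s * S\<bar> \<le> s * P" "\<bar>s' * S'\<bar> \<le> s' * P'"
    using assms by (auto simp: abs_mult intro: mult_left_mono)
  then show ?thesis using assms(3) by linarith
qed

text \<open>The weights are nonnegative and telescope to \<open>l_coef \<gamma> 1\<close>; for
  \<open>k = 1\<close> the sum is empty and \<open>l_coef \<gamma> k\<close> is the whole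
  weight.\<close>

lemma history_bound:
  fixes v :: "nat \<Rightarrow> real"
  assumes "0 < \<gamma>" "\<gamma> \<le> 1" "1 \<le> k" and v: "\<And>s. s \<le> k \<Longrightarrow> \<bar>v s\<bar> \<le> E"
  shows "\<bar>(\<Sum>s=1..k-1. (l_coef \<gamma> s - l_coef \<gamma> (s + 1)) * v (k - s)) + l_coef \<gamma> k * v 0\<bar>
    \<le> l_coef \<gamma> 1 * E"
proof -
  have "\<bar>\<Sum>s=1..k-1. (l_coef \<gamma> s - l_coef \<gamma> (s + 1)) * v (k - s)\<bar>
      \<le> (\<Sum>s=1..k-1. (l_coef \<gamma> s - l_coef \<gamma> (s + 1)) * E)"
    using v l_coef_decreasing[OF assms(1,2)]
    by (intro order_trans[OF sum_abs] sum_mono) (auto simp: abs_mult intro!: mult_left_mono)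
  also have "\<dots> = (l_coef \<gamma> 1 - l_coef \<gamma> k) * E"
  proof -
    have "(\<Sum>s=1..n. l_coef \<gamma> s - l_coef \<gamma> (s + 1)) = l_coef \<gamma> 1 - l_coef \<gamma> (n + 1)" for n
      by (induction n) auto
    from this[of "k - 1"] show ?thesis using \<open>1 \<le> k\<close> by (simp flip: sum_distrib_right)
  qed
  finally have "\<bar>\<Sum>s=1..k-1. (l_coef \<gamma> s - l_coef \<gamma> (s + 1)) * v (k - s)\<bar>
      \<le> (l_coef \<gamma> 1 - l_coef \<gamma> k) * E" .
  moreover have "\<bar>l_coef \<gamma> k * v 0\<bar> \<le> l_coef \<gamma> k * E"
    using v[of 0] l_coef_nonneg[of \<gamma> k] assms by (auto simp: abs_mult intro: mult_left_mono)
  ultimately show ?thesis by (simp add: algebra_simps)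
qed

theorem theorem3p6:
  fixes \<gamma> \<alpha> \<beta> xL xR yL yR T \<Delta>x \<Delta>y \<tau> :: real
    and Nx Ny Nt :: nat
    and c d f :: "real \<Rightarrow> real \<Rightarrow> real \<Rightarrow> real"
    and C D F \<epsilon> u u' :: "nat \<Rightarrow> nat \<Rightarrow> nat \<Rightarrow> real"
    and \<phi> \<phi>' :: "nat \<Rightarrow> nat \<Rightarrow> real"
    and \<psi> :: "nat \<Rightarrow> nat \<Rightarrow> nat \<Rightarrow> real"
  assumes "0 < \<gamma>" "\<gamma> \<le> 1" and "1 < \<alpha>" "\<alpha> \<le> 2" and "1 < \<beta>" "\<beta> \<le> 2"
    and "xL < xR" and "yL < yR" and "0 < T"
    and "Nx \<ge> 2" and "Ny \<ge> 2" and "Nt \<ge> 1"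
    and "\<Delta>x = (xR - xL) / real Nx" and "\<Delta>y = (yR - yL) / real Ny" and "\<tau> = T / real Nt"
    and "\<And>x y t. x \<in> {xL..xR} \<Longrightarrow> y \<in> {yL..yR} \<Longrightarrow> t \<in> {0..T} \<Longrightarrow> c x y t \<ge> 0"
    and "\<And>x y t. x \<in> {xL..xR} \<Longrightarrow> y \<in> {yL..yR} \<Longrightarrow> t \<in> {0..T} \<Longrightarrow> d x y t \<ge> 0"
    and "C = grid_value xL yL \<Delta>x \<Delta>y \<tau> c"
    and "D = grid_value xL yL \<Delta>x \<Delta>y \<tau> d"
    and "F = grid_value xL yL \<Delta>x \<Delta>y \<tau> f"
    and "step_size_condition \<gamma> \<alpha> \<beta> \<tau> \<Delta>x \<Delta>y (C_max \<alpha> \<beta> Nx Ny Nt C D)"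
    and "explicit_scheme_solution \<gamma> \<alpha> \<beta> \<tau> \<Delta>x \<Delta>y Nx Ny Nt C D F \<phi> \<psi> u"
    and "explicit_scheme_solution \<gamma> \<alpha> \<beta> \<tau> \<Delta>x \<Delta>y Nx Ny Nt C D F \<phi>' \<psi> u'"
    and "\<epsilon> = (\<lambda>i j k. u' i j k - u i j k)"
  shows "\<forall>k\<in>{1..Nt}.
    grid_norm Nx Ny (\<lambda>i j. \<epsilon> i j k) \<le> grid_norm Nx Ny (\<lambda>i j. \<epsilon> i j 0)"
proof -
  note \<gamma> = assms(1,2) and \<alpha> = assms(3,4) and \<beta> = assms(5,6)
  note step = assms(21) and u = assms(22) and u' = assms(23) and \<epsilon> = assms(24)
  define E where "E = grid_norm Nx Ny (\<lambda>i j. \<epsilon> i j 0)"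
  \<comment> \<open>Grid nodes must lie in the domain, where alone the signs of \<open>c\<close> and
    \<open>d\<close> are given; time is the case \<open>a = 0\<close>.\<close>
  have node: "a + real n * h \<in> {a..b}" if "h = (b - a) / real N" "n \<le> N" "0 < N" "a < b"
    for a b h :: real and n N
  proof -
    have "0 \<le> h" using that by simp
    then have "real n * h \<le> real N * h" "0 \<le> real n * h"
      using \<open>n \<le> N\<close> by (auto intro: mult_right_mono)
    moreover have "real N * h = b - a" using that by simp
    ultimately show ?thesis by auto
  qed
  have nodes: "xL + real i * \<Delta>x \<in> {xL..xR}" "yL + real j * \<Delta>y \<in> {yL..yR}" "real k * \<tau> \<in> {0..T}"
    if "i \<le> Nx" "j \<le> Ny" "k \<le> Nt" for i j k
    using node[of \<Delta>x xR xL Nx i] node[of \<Delta>y yR yL Ny j] node[of \<tau> T 0 Nt k] assms that by auto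
  have C: "0 \<le> C i j k" and D: "0 \<le> D i j k" if "i \<le> Nx" "j \<le> Ny" "k \<le> Nt" for i j k
    using assms(16)[OF nodes[OF that]] assms(17)[OF nodes[OF that]] assms(18,19)
    by (auto simp: grid_value_def)
  have bound: "\<bar>\<epsilon> i j k\<bar> \<le> E" if "i \<le> Nx" "j \<le> Ny" "k \<le> Nt" for i j k
    using that
  \<comment> \<open>Strong induction, as the history reaches back to level 0; the node is arbitrary
    because the space sums run along whole grid lines.\<close>
  proof (induction k arbitrary: i j rule: less_induct)
    case (less k)
    consider "k = 0" | "i \<in> {0, Nx} \<or> j \<in> {0, Ny}" | n where
      "k = n + 1" "1 \<le> i" "i < Nx" "1 \<le> j" "j < Ny"
      using less.prems by (cases k) fastforce+
    then show ?case
    proof cases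
      case 1
      then show ?thesis
        using grid_norm_ge[OF less.prems(1,2), of "\<lambda>i j. \<epsilon> i j 0"] by (simp add: E_def)
    next
      case 2
      then have "u i j k = \<psi> i j k" "u' i j k = \<psi> i j k"
        using explicit_scheme_boundary[OF u, of k i j] explicit_scheme_boundary[OF u', of k i j]
          less.prems by simp_all
      \<comment> \<open>The boundary error is zero, so \<open>0 \<le> E\<close> suffices, read off
        at node (0, 0).\<close>
      moreover have "\<bar>\<epsilon> 0 0 0\<bar> \<le> E"
        unfolding E_def by (rule grid_norm_ge[of 0 Nx 0 Ny "\<lambda>i j. \<epsilon> i j 0"]) auto
      ultimately show ?thesis by (simp add: \<epsilon>)
    next
      case 3
      then have n: "n < Nt" and ij: "i \<in> {1..Nx-1}" "j \<in> {1..Ny-1}" using less.prems by auto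
      have IH: "\<bar>\<epsilon> i j s\<bar> \<le> E" if "i \<le> Nx" "j \<le> Ny" "s \<le> n" for i j s
        using less.IH[of s i j] 3 n that by simp
      let ?s = "sigma \<gamma> \<alpha> \<tau> \<Delta>x (C i j n)" and ?s' = "sigma \<gamma> \<beta> \<tau> \<Delta>y (D i j n)"
      let ?g = "g_coef \<alpha> Nx i" and ?g' = "g_coef \<beta> Ny j"
      \<comment> \<open>The first step has weight 1 and no history; the conditionals give it the
        same form as the later steps.\<close>
      define w where "w = (if n = 0 then 1 else 1 - l_coef \<gamma> 1) + ?s * ?g i + ?s' * ?g' j"
      define h where "h = (if n = 0 then 0 else
        (\<Sum>s=1..n-1. (l_coef \<gamma> s - l_coef \<gamma> (s + 1)) * \<epsilon> i j (n - s)) + l_coef \<gamma> n * \<epsilon> i j 0)"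
      define H where "H = (if n = 0 then 0 else l_coef \<gamma> 1 * E)"
      have "\<epsilon> i j k = w * \<epsilon> i j n + h + ?s * (\<Sum>m\<in>{0..Nx} - {i}. ?g m * \<epsilon> m j n)
          + ?s' * (\<Sum>m\<in>{0..Ny} - {j}. ?g' m * \<epsilon> i m n)"
      proof (cases "n = 0")
        case True
        then show ?thesis
          using explicit_scheme_first_step[OF u ij] explicit_scheme_first_step[OF u' ij] 3
          by (simp add: \<epsilon> w_def h_def right_diff_distrib sum_subtractf)
      next
        case False
        then have "n \<in> {1..Nt-1}" using n by auto
        then show ?thesis
          using explicit_scheme_step[OF u _ ij] explicit_scheme_step[OF u' _ ij] 3 False
          by (simp add: \<epsilon> w_def h_def right_diff_distrib sum_subtractf)
      qed
      also have "\<bar>\<dots>\<bar> \<le> w * E + H + ?s * (- ?g i * E) + ?s' * (- ?g' j * E)"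
      proof (rule abs_five_term_bound)
        \<comment> \<open>For \<open>n = 0\<close> the weight is larger by
          \<open>l_coef \<gamma> 1\<close>, which is nonnegative.\<close>
        show "0 \<le> w"
          using diag_weight_nonneg[OF \<gamma>(2) step 3(2-5), of n] l_coef_nonneg[OF \<gamma>(2), of 1] n \<gamma>
          by (auto simp: w_def)
        show "\<bar>h\<bar> \<le> H"
          using history_bound[OF \<gamma>, of n "\<epsilon> i j" E] IH[of i j] 3 by (auto simp: h_def H_def)
        show "0 \<le> ?s" "0 \<le> ?s'"
          using C[of i j n] D[of i j n] 3 n \<gamma> \<alpha> \<beta> by (auto intro!: sigma_nonneg)
        show "\<bar>\<Sum>m\<in>{0..Nx} - {i}. ?g m * \<epsilon> m j n\<bar> \<le> - ?g i * E"
          using 3 \<alpha> IH by (intro g_coef_off_diag_sum_bound) auto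
        show "\<bar>\<Sum>m\<in>{0..Ny} - {j}. ?g' m * \<epsilon> i m n\<bar> \<le> - ?g' j * E"
          using 3 \<beta> IH by (intro g_coef_off_diag_sum_bound) auto
        show "\<bar>\<epsilon> i j n\<bar> \<le> E" using IH 3 by simp
      qed
      \<comment> \<open>The diagonal terms of \<open>w\<close> cancel the bounds of the space sums,
        and its \<open>l_coef \<gamma> 1\<close> that of the history, so the total weight is
        1.\<close>
      also have "\<dots> = E"
        by (simp add: w_def H_def algebra_simps)
      finally show ?thesis .
    qed
  qed
  then show ?thesis
    unfolding E_def by (auto intro!: grid_norm_le)
qed

end
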